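(* The set $P=\{A\in F(\ell_2)\mid A\text{ is purely unrectifiable}\}$ is $\Pi^1_1$ (as a subset of $F(\ell_2)$, the space of all closed subsets of $\ell_2$).
   Context: $\ell_2$ is the (real, separable, infinite-dimensional) Hilbert space of square-summable sequences with norm $\|\cdot\|_2$. $C^1$-curves. A Fréchet derivative of $f\colon[0,1]\to\ell_2$ at $x\in[0,1]$ is a linear operator $A_x\colon\mathbb{R}\to\ell_2$ such that $\lim_{h\to 0}\frac{\|f(x+h)-f(x)-A_xh\|_2}{|h|}=0$ (with $x+h\in[0,1]$). The function $f$ is $C^1$ if the Fréchet derivative exists at every point of $[0,1]$ and the map $x\mapsto A_x$ is continuous in the operator norm. Purely unrectifiable sets. A subset $N\subset\ell_2$ is purely unrectifiable (short for purely $1$-unrectifiable) if for every $C^1$-map $f\colon[0,1]\to\ell_2$ we have $\mathcal{H}^1(N\cap\operatorname{ran}(f))=0$, where $\mathcal{H}^1$ is the one-dimensional Hausdorff measure and $\operatorname{ran}(f)$ is the range of $f$. The space $F(\ell_2)$. $F(\ell_2)$ is the set of all closed subsets of $\ell_2$. It is a standard Borel space with the $\sigma$-algebra generated by the sets $\{A\in F(\ell_2)\mid A\cap U\neq\varnothing\}$, where $U$ ranges over the basic open subsets of $\ell_2$. It is regarded as a Polish space via a Polish topology whose Borel sets are exactly this $\sigma$-algebra. Descriptive set theory. A subset $A$ of a Polish space $X$ is $\Sigma^1_1$ if there are a Polish space $Y$ and a Borel set $B\subset X\times Y$ such that $A$ is the projection of $B$ to $X$; it is $\Pi^1_1$ if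 it is the complement of a $\Sigma^1_1$ set. *)

theory Defs
  imports "HOL-Analysis.Analysis"
begin

section \<open>The Hilbert space of square-summable sequences\<close>

typedef ell2 = "{x :: nat \<Rightarrow> real. summable (\<lambda>i. (x i)\<^sup>2)}"
  morphisms seq_of Abs_ell2
  by (rule exI[of _ "\<lambda>_. 0"]) simp

setup_lifting type_definition_ell2

lemma summable_seq_of: "summable (\<lambda>i. (seq_of x i)\<^sup>2)"
  using seq_of by blast

lemma summable_mult_of_squares:
  fixes x y :: "nat \<Rightarrow> real"
  assumes "summable (\<lambda>i. (x i)\<^sup>2)" "summable (\<lambda>i. (y i)\<^sup>2)"
  shows "summable (\<lambda>i. x i * y i)"
proof (rule summable_comparison_test')
  show "summable (\<lambda>i. (x i)\<^sup>2 + (y i)\<^sup>2)"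
    using assms by (rule summable_add)
  fix i
  have "2 * (\<bar>x i\<bar> * \<bar>y i\<bar>) \<le> (x i)\<^sup>2 + (y i)\<^sup>2"
    using sum_squares_bound[of "\<bar>x i\<bar>" "\<bar>y i\<bar>"] by simp
  moreover have "0 \<le> \<bar>x i\<bar> * \<bar>y i\<bar>" by simp
  ultimately show "norm (x i * y i) \<le> (x i)\<^sup>2 + (y i)\<^sup>2"
    by (simp only: real_norm_def abs_mult)
qed

instantiation ell2 :: real_inner
begin

lift_definition zero_ell2 :: ell2 is "\<lambda>_. 0" by simp

lift_definition plus_ell2 :: "ell2 \<Rightarrow> ell2 \<Rightarrow> ell2" is "\<lambda>x y i. x i + y i"
  by (auto simp: power2_sum mult.assoc
      intro!: summable_add summable_mult summable_mult_of_squares)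

lift_definition uminus_ell2 :: "ell2 \<Rightarrow> ell2" is "\<lambda>x i. - x i" by simp

lift_definition minus_ell2 :: "ell2 \<Rightarrow> ell2 \<Rightarrow> ell2" is "\<lambda>x y i. x i - y i"
  by (auto simp: power2_diff mult.assoc
      intro!: summable_add summable_diff summable_mult summable_mult_of_squares)

lift_definition scaleR_ell2 :: "real \<Rightarrow> ell2 \<Rightarrow> ell2" is "\<lambda>r x i. r * x i"
  by (auto simp: power_mult_distrib intro!: summable_mult)

definition inner_ell2 :: "ell2 \<Rightarrow> ell2 \<Rightarrow> real"
  where "inner_ell2 x y = (\<Sum>i. seq_of x i * seq_of y i)"

definition norm_ell2 :: "ell2 \<Rightarrow> real"
  where "norm_ell2 x = sqrt (\<Sum>i. (seq_of x i)\<^sup>2)"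

definition sgn_ell2 :: "ell2 \<Rightarrow> ell2"
  where "sgn_ell2 x = inverse (norm x) *\<^sub>R x"

definition dist_ell2 :: "ell2 \<Rightarrow> ell2 \<Rightarrow> real"
  where "dist_ell2 x y = norm (x - y)"

definition uniformity_ell2 :: "(ell2 \<times> ell2) filter"
  where "uniformity_ell2 = (INF e\<in>{0<..}. principal {(x, y). dist x y < e})"

definition open_ell2 :: "ell2 set \<Rightarrow> bool"
  where "open_ell2 U \<longleftrightarrow> (\<forall>x\<in>U. \<forall>\<^sub>F (x', y) in uniformity. x' = x \<longrightarrow> y \<in> U)"

instance
proof
  fix x y z :: ell2 and r s :: real and U :: "ell2 set"
  note sm = summable_mult_of_squares[OF summable_seq_of summable_seq_of]
  show "x + y + z = x + (y + z)" by transfer (simp add: add.assoc)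
  show "x + y = y + x" by transfer (simp add: add.commute)
  show "0 + x = x" by transfer simp
  show "- x + x = 0" by transfer simp
  show "x - y = x + - y" by transfer simp
  show "r *\<^sub>R (x + y) = r *\<^sub>R x + r *\<^sub>R y" by transfer (simp add: distrib_left)
  show "(r + s) *\<^sub>R x = r *\<^sub>R x + s *\<^sub>R x" by transfer (simp add: distrib_right)
  show "r *\<^sub>R s *\<^sub>R x = (r * s) *\<^sub>R x" by transfer (simp add: mult.assoc)
  show "1 *\<^sub>R x = x" by transfer simp
  show "sgn x = inverse (norm x) *\<^sub>R x" by (rule sgn_ell2_def)
  show "dist x y = norm (x - y)" by (rule dist_ell2_def)
  show "uniformity = (INF e\<in>{0<..}. principal {(x :: ell2, y). dist x y < e})"
    by (rule uniformity_ell2_def)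
  show "open U = (\<forall>x\<in>U. \<forall>\<^sub>F (x', y) in uniformity. x' = x \<longrightarrow> y \<in> U)"
    by (rule open_ell2_def)
  show "inner x y = inner y x" by (simp add: inner_ell2_def mult.commute)
  show "inner (x + y) z = inner x z + inner y z"
    by (simp add: inner_ell2_def plus_ell2.rep_eq distrib_right suminf_add[OF sm sm])
  show "inner (r *\<^sub>R x) y = r * inner x y"
    by (simp add: inner_ell2_def scaleR_ell2.rep_eq mult.assoc suminf_mult[OF sm])
  show "0 \<le> inner x x"
    by (simp add: inner_ell2_def suminf_nonneg[OF sm])
  show "inner x x = 0 \<longleftrightarrow> x = 0"
    by (simp add: inner_ell2_def suminf_eq_zero_iff[OF sm] seq_of_inject[symmetric]
        zero_ell2.rep_eq fun_eq_iff)
  show "norm x = sqrt (inner x x)"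
    by (simp add: norm_ell2_def inner_ell2_def power2_eq_square)
qed

end

section \<open>One-dimensional Hausdorff measure and pure unrectifiability\<close>

text \<open>
  Boundedness of the covering sets is required explicitly because \<^const>\<open>diameter\<close> is
  real-valued and has no meaningful value on unbounded sets.  Finite covers are included, since
  some of the sets \<open>E i\<close> may be empty.
\<close>

definition hausdorff_content1 :: "real \<Rightarrow> 'a::metric_space set \<Rightarrow> ennreal"
  where "hausdorff_content1 \<delta> A =
    (INF E\<in>{E :: nat \<Rightarrow> 'a set. (\<forall>i. bounded (E i) \<and> diameter (E i) \<le> \<delta>) \<and> A \<subseteq> (\<Union>i. E i)}.
       \<Sum>i. ennreal (diameter (E i)))"

definition hausdorff_measure1 :: "'a::metric_space set \<Rightarrow> ennreal"
  where "hausdorff_measure1 A = (SUP \<delta>\<in>{0<..}. hausdorff_content1 \<delta> A)"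

definition C1_curve :: "(real \<Rightarrow> 'a::real_normed_vector) \<Rightarrow> bool"
  where "C1_curve f \<longleftrightarrow>
    (\<exists>f' :: real \<Rightarrow> real \<Rightarrow>\<^sub>L 'a.
       (\<forall>x\<in>{0..1}. (f has_derivative blinfun_apply (f' x)) (at x within {0..1})) \<and>
       continuous_on {0..1} f')"

definition purely_unrectifiable :: "'a::real_normed_vector set \<Rightarrow> bool"
  where "purely_unrectifiable N \<longleftrightarrow>
    (\<forall>f. C1_curve f \<longrightarrow> hausdorff_measure1 (N \<inter> f ` {0..1}) = 0)"

section \<open>The Effros Borel space\<close>

definition effros :: "'a::topological_space set measure"
  where "effros = sigma {A. closed A} {{A. closed A \<and> A \<inter> U \<noteq> {}} | U. open U}"

section \<open>Analytic and coanalytic sets in Polish spaces\<close>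

definition polish_topology :: "'a topology \<Rightarrow> bool"
  where "polish_topology X \<longleftrightarrow> completely_metrizable_space X \<and> separable_space X"

definition borel_of :: "'a topology \<Rightarrow> 'a measure"
  where "borel_of X = sigma (topspace X) {U. openin X U}"

text \<open>
  The auxiliary Polish space \<open>Y\<close> ranges over all Polish topologies on arbitrary subsets of
  \<^typ>\<open>nat \<Rightarrow> real\<close>.  This is no restriction: a Polish space has at most continuum
  many points, hence is homeomorphic to a space of this kind, and the existence of \<open>B\<close> is invariant
  under homeomorphisms of \<open>Y\<close>.  The topology on the carrier need not be inherited from the
  product topology.
\<close>

definition analytic_in :: "'a topology \<Rightarrow> 'a set \<Rightarrow> bool"
  where "analytic_in X A \<longleftrightarrow>
    (\<exists>Y :: (nat \<Rightarrow> real) topology. polish_topology Y \<and>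
       (\<exists>B \<in> sets (borel_of (prod_topology X Y)). A = fst ` B))"

definition coanalytic_in :: "'a topology \<Rightarrow> 'a set \<Rightarrow> bool"
  where "coanalytic_in X A \<longleftrightarrow> A \<subseteq> topspace X \<and> analytic_in X (topspace X - A)"

end

theory Submission
  imports Defs
begin

text \<open>
  A closed set \<open>A\<close> fails to be purely unrectifiable iff some \<open>C\<^sup>1\<close>-curve \<open>f\<close> meets it in a set of
  positive \<open>\<H>\<^sup>1\<close>-measure.  The complement is therefore a projection along the space of curves, and
  the task is to describe the pairs of a set and a curve by countably many Borel conditions on
  points of a Polish space.  Three observations make this possible.

  Since \<open>\<ell>\<^sub>2\<close> is complete, a \<open>C\<^sup>1\<close>-curve on \<open>[0,1]\<close> is the same thing as a pair of functions \<open>p\<close>, \<open>g\<close>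
  on the rationals of \<open>[0,1]\<close> that satisfy the uniform estimate
  \<open>\<parallel>p t - p s - (t - s) g s\<parallel> \<le> \<epsilon> \<bar>s - t\<bar>\<close> for \<open>\<bar>s - t\<bar> < \<delta>(\<epsilon>)\<close>
  (\<open>C1_curve_iff_uniform_deriv_on\<close>, \<open>uniform_deriv_on_extend\<close>).  The range of the curve is then the
  closure of the values of \<open>p\<close>.

  The set \<open>K = A \<inter> ran f\<close> is compact.  Hence \<open>\<H>\<^sup>1(K) = 0\<close> iff for every \<open>\<epsilon>\<close> there are
  finitely many balls with rational radii of sum less than \<open>\<epsilon>\<close> that cover \<open>K\<close>, and the centres
  can be taken among the values of \<open>p\<close>
  (\<open>hausdorff_measure1_eq_0I\<close>, \<open>small_ball_union_of_null_compact\<close>).  There are only countably many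
  such families of balls.

  Positivity of \<open>\<H>\<^sup>1(K)\<close> thus says that for some \<open>\<epsilon>\<close> every small family \<open>c\<close> leaves out a point \<open>w c\<close>
  of \<open>K\<close>.  These points join \<open>p\<close> and \<open>g\<close> as further projected coordinates, so no quantifier over
  the points of \<open>K\<close> remains (\<open>not_purely_unrectifiable_iff\<close>).  All coordinates together
  form an element of a countable power of \<open>\<ell>\<^sub>2\<close>, which is Polish, and the remaining
  conditions are Borel because membership of a point in a closed set is a Borel relation for the
  Effros structure (\<open>pred_mem_closed_set\<close>).
\<close>

section \<open>The sequence space as a Polish space\<close>

lemma ell2_norm_sq: "(norm x)\<^sup>2 = (\<Sum>i. (seq_of x i)\<^sup>2)"
  by (simp add: norm_ell2_def suminf_nonneg summable_seq_of)

lemma sum_sq_le_norm_sq: "(\<Sum>i<N. (seq_of x i)\<^sup>2) \<le> (norm x)\<^sup>2"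
  unfolding ell2_norm_sq by (intro sum_le_suminf summable_seq_of) auto

lemma coord_le_norm: "\<bar>seq_of x i\<bar> \<le> norm x"
proof (rule power2_le_imp_le)
  have "(seq_of x i)\<^sup>2 \<le> (\<Sum>j<Suc i. (seq_of x j)\<^sup>2)"
    by (simp add: sum_nonneg)
  with sum_sq_le_norm_sq[of x "Suc i"] show "\<bar>seq_of x i\<bar>\<^sup>2 \<le> (norm x)\<^sup>2"
    by simp
qed simp

lemma norm_le_of_sum_sq_le:
  assumes "\<And>N. (\<Sum>i<N. (seq_of x i)\<^sup>2) \<le> e\<^sup>2" "0 \<le> e"
  shows "norm x \<le> e"
proof (rule power2_le_imp_le)
  show "(norm x)\<^sup>2 \<le> e\<^sup>2"
    unfolding ell2_norm_sq by (rule suminf_le_const[OF summable_seq_of]) (rule assms)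
qed fact

instance ell2 :: complete_space
proof
  fix X :: "nat \<Rightarrow> ell2"
  assume X: "Cauchy X"
  have "Cauchy (\<lambda>n. seq_of (X n) i)" for i
  proof (rule CauchyI)
    fix e :: real assume "0 < e"
    with X obtain M where M: "\<And>m n. M \<le> m \<Longrightarrow> M \<le> n \<Longrightarrow> norm (X m - X n) < e"
      by (meson CauchyD)
    have "norm (seq_of (X m) i - seq_of (X n) i) < e" if "M \<le> m" "M \<le> n" for m n
      using coord_le_norm[of "X m - X n" i] M[OF that] by (simp add: minus_ell2.rep_eq)
    then show "\<exists>M. \<forall>m\<ge>M. \<forall>n\<ge>M. norm (seq_of (X m) i - seq_of (X n) i) < e" by blast
  qed
  then obtain y where y: "\<And>i. (\<lambda>n. seq_of (X n) i) \<longlonglongrightarrow> y i"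
    unfolding Cauchy_convergent_iff convergent_def by metis
  \<comment> \<open>The Cauchy estimate passes to the coordinatewise limit on each finite initial segment.\<close>
  have close: "\<exists>M. \<forall>n\<ge>M. \<forall>N. (\<Sum>i<N. (seq_of (X n) i - y i)\<^sup>2) \<le> e\<^sup>2" if "0 < e" for e
  proof -
    obtain M where M: "\<And>m n. M \<le> m \<Longrightarrow> M \<le> n \<Longrightarrow> norm (X m - X n) < e"
      using X \<open>0 < e\<close> by (meson CauchyD)
    have "(\<Sum>i<N. (seq_of (X n) i - y i)\<^sup>2) \<le> e\<^sup>2" if "M \<le> n" for n N
    proof (rule tendsto_upperbound)
      show "(\<lambda>m. \<Sum>i<N. (seq_of (X n) i - seq_of (X m) i)\<^sup>2)
              \<longlonglongrightarrow> (\<Sum>i<N. (seq_of (X n) i - y i)\<^sup>2)"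
        by (intro tendsto_intros y)
      have "(\<Sum>i<N. (seq_of (X n) i - seq_of (X m) i)\<^sup>2) \<le> e\<^sup>2" if "M \<le> m" for m
        using sum_sq_le_norm_sq[of "X n - X m" N] M[OF \<open>M \<le> n\<close> that]
          power_strict_mono[of "norm (X n - X m)" e 2]
        by (simp add: minus_ell2.rep_eq)
      then show "\<forall>\<^sub>F m in sequentially. (\<Sum>i<N. (seq_of (X n) i - seq_of (X m) i)\<^sup>2) \<le> e\<^sup>2"
        by (auto simp: eventually_sequentially)
    qed simp
    then show ?thesis by blast
  qed
  obtain M where M: "\<And>N. (\<Sum>i<N. (seq_of (X M) i - y i)\<^sup>2) \<le> 1\<^sup>2"
    using close[of 1] by auto
  \<comment> \<open>Square-summability of the limit: it differs from a member of the sequence by a square-summable amount.\<close>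
  have "summable (\<lambda>i. (seq_of (X M) i - y i)\<^sup>2)"
    by (rule summableI_nonneg_bounded[where x = "1\<^sup>2"]) (use M in auto)
  then have "summable (\<lambda>i. (seq_of (X M - Abs_ell2 (\<lambda>i. seq_of (X M) i - y i)) i)\<^sup>2)"
    by (intro summable_seq_of)
  moreover have "seq_of (X M - Abs_ell2 (\<lambda>i. seq_of (X M) i - y i)) = y"
    using \<open>summable (\<lambda>i. (seq_of (X M) i - y i)\<^sup>2)\<close>
    by (simp add: minus_ell2.rep_eq Abs_ell2_inverse)
  ultimately obtain z where z: "seq_of z = y" by blast
  have "X \<longlonglongrightarrow> z"
  proof (rule metric_LIMSEQ_I)
    fix e :: real assume "0 < e"
    then obtain M where M: "\<And>n N. M \<le> n \<Longrightarrow> (\<Sum>i<N. (seq_of (X n) i - y i)\<^sup>2) \<le> (e/2)\<^sup>2"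
      using close[of "e/2"] by auto
    have "dist (X n) z < e" if "M \<le> n" for n
    proof -
      have "norm (X n - z) \<le> e/2"
        by (rule norm_le_of_sum_sq_le) (use M that \<open>0 < e\<close> in \<open>auto simp: minus_ell2.rep_eq z\<close>)
      with \<open>0 < e\<close> show ?thesis by (simp add: dist_norm)
    qed
    then show "\<exists>M. \<forall>n\<ge>M. dist (X n) z < e" by blast
  qed
  then show "convergent X" by (auto simp: convergent_def)
qed

instance ell2 :: banach ..

lemma second_countable_of_countable_dense:
  fixes D :: "'a::metric_space set"
  assumes "countable D" and dense: "\<And>x e. 0 < e \<Longrightarrow> \<exists>d\<in>D. dist x d < e"
  shows "\<exists>B::'a set set. countable B \<and> open = generate_topology B"
proof -
  define B where "B = (\<lambda>(d, q). ball d (real_of_rat q)) ` (D \<times> UNIV)"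
  have "topological_basis B"
  proof (rule topological_basisI)
    fix U :: "'a set" and x assume "open U" "x \<in> U"
    then obtain e where e: "0 < e" "ball x e \<subseteq> U" by (meson openE)
    obtain q where q: "0 < real_of_rat q" "real_of_rat q < e/2"
      using of_rat_dense[of 0 "e/2"] e by auto
    obtain d where d: "d \<in> D" "dist x d < real_of_rat q" using dense q(1) by blast
    have "ball d (real_of_rat q) \<subseteq> ball x e"
    proof
      fix y assume "y \<in> ball d (real_of_rat q)"
      then show "y \<in> ball x e"
        using dist_triangle[of x y d] d q by simp
    qed
    moreover have "ball d (real_of_rat q) \<in> B" using d by (auto simp: B_def)
    ultimately show "\<exists>V\<in>B. x \<in> V \<and> V \<subseteq> U" using d e by (metis mem_ball dist_commute order_trans)
  qed (auto simp: B_def)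
  moreover have "countable B" using assms(1) by (simp add: B_def)
  ultimately show ?thesis using topological_basis_imp_subbasis by blast
qed

text \<open>
  The finitely supported rational sequences are dense: cut off a tail of small norm and
  approximate the finitely many remaining coordinates.
\<close>

instance ell2 :: second_countable_topology
proof
  define v :: "rat list \<Rightarrow> nat \<Rightarrow> real" where "v l i = (if i < length l then real_of_rat (l ! i) else 0)" for l i
  have v: "seq_of (Abs_ell2 (v l)) = v l" for l
    by (rule Abs_ell2_inverse) (auto intro!: summable_finite[of "{..<length l}"] simp: v_def split: if_splits)
  have "\<exists>l. dist x (Abs_ell2 (v l)) < e" if "0 < e" for x e
  proof -
    define s where "s i = (seq_of x i)\<^sup>2" for i
    have s: "summable s" unfolding s_def by (rule summable_seq_of)
    obtain N where "norm (\<Sum>i. s (i + N)) < e\<^sup>2/2"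
      using suminf_exist_split[OF _ s, of "e\<^sup>2/2"] \<open>0 < e\<close> by (meson half_gt_zero order_refl zero_less_power)
    then have N: "(\<Sum>i. s (i + N)) < e\<^sup>2/2" by (simp only: real_norm_def abs_less_iff)
    \<comment> \<open>With this coordinatewise error, the first \<open>N\<close> coordinates contribute at most \<open>e\<^sup>2/4\<close>.\<close>
    define d where "d = e / (2 * (real N + 1))"
    have "0 < d" using \<open>0 < e\<close> by (simp add: d_def)
    have "\<exists>q. \<bar>seq_of x i - real_of_rat q\<bar> < d" for i
    proof -
      have "seq_of x i - d < seq_of x i + d" using \<open>0 < d\<close> by simp
      from of_rat_dense[OF this] obtain q
        where "seq_of x i - d < real_of_rat q" "real_of_rat q < seq_of x i + d" by blast
      then have "\<bar>seq_of x i - real_of_rat q\<bar> < d" by (simp add: abs_less_iff)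
      then show ?thesis ..
    qed
    then obtain q where q: "\<And>i. \<bar>seq_of x i - real_of_rat (q i)\<bar> < d" by metis
    define l where "l = map q [0..<N]"
    have "(\<Sum>i<N. (seq_of x i - v l i)\<^sup>2) \<le> (\<Sum>i<N. d\<^sup>2)"
    proof (rule sum_mono)
      fix i assume "i \<in> {..<N}"
      then have "v l i = real_of_rat (q i)" by (simp add: v_def l_def)
      then show "(seq_of x i - v l i)\<^sup>2 \<le> d\<^sup>2"
        using q[of i] \<open>0 < d\<close> power_mono[of "\<bar>seq_of x i - v l i\<bar>" d 2] by simp
    qed
    also have "\<dots> \<le> (real N + 1)\<^sup>2 * d\<^sup>2"
    proof -
      have "real N \<le> (real N + 1)\<^sup>2" by (simp add: power2_eq_square algebra_simps)
      then show ?thesis by (simp add: mult_right_mono)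
    qed
    also have "\<dots> = e\<^sup>2/4"
    proof -
      have "(real N + 1) * d = e/2"
        unfolding d_def by (simp add: divide_simps)
      then have "((real N + 1) * d)\<^sup>2 = (e/2)\<^sup>2" by (rule arg_cong)
      then show ?thesis by (simp add: power_divide power_mult_distrib)
    qed
    finally have head: "(\<Sum>i<N. (seq_of x i - v l i)\<^sup>2) \<le> e\<^sup>2/4" .
    have sd: "summable (\<lambda>i. (seq_of x i - v l i)\<^sup>2)"
      using summable_seq_of[of "x - Abs_ell2 (v l)"] by (simp add: minus_ell2.rep_eq v)
    have "(norm (x - Abs_ell2 (v l)))\<^sup>2 = (\<Sum>i. (seq_of x i - v l i)\<^sup>2)"
      by (simp add: ell2_norm_sq minus_ell2.rep_eq v)
    also have "\<dots> = (\<Sum>i. (seq_of x (i + N) - v l (i + N))\<^sup>2) + (\<Sum>i<N. (seq_of x i - v l i)\<^sup>2)"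
      by (rule suminf_split_initial_segment[OF sd])
    also have "(\<Sum>i. (seq_of x (i + N) - v l (i + N))\<^sup>2) = (\<Sum>i. s (i + N))"
      by (simp add: v_def l_def s_def)
    also have "(\<Sum>i. s (i + N)) + (\<Sum>i<N. (seq_of x i - v l i)\<^sup>2) < e\<^sup>2"
      using N head by (simp add: field_simps) (use \<open>0 < e\<close> zero_less_power[of e 2] in linarith)
    finally show ?thesis
      using \<open>0 < e\<close> power2_less_imp_less[of "norm (x - Abs_ell2 (v l))" e] by (auto simp: dist_norm)
  qed
  then show "\<exists>B::ell2 set set. countable B \<and> open = generate_topology B"
    by (intro second_countable_of_countable_dense[of "range (\<lambda>l. Abs_ell2 (v l))"]) auto
qed

instance ell2 :: polish_space ..

section \<open>Compact null sets and finite families of balls\<close>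

text \<open>
  A list of pairs of a centre index and a rational radius describes a finite family of balls.
  Indices rather than centres are recorded so that, for a countable index type, the families form
  a countable type even when the centres \<open>d\<close> vary.  A nonpositive radius stands for an empty
  ball; the absolute value keeps such entries from lowering the total.
\<close>

definition total_radius :: "('i \<times> rat) list \<Rightarrow> real"
  where "total_radius c = (\<Sum>(i, r)\<leftarrow>c. \<bar>real_of_rat r\<bar>)"

definition ball_union :: "('i \<Rightarrow> 'a::metric_space) \<Rightarrow> ('i \<times> rat) list \<Rightarrow> 'a set"
  where "ball_union d c = (\<Union>(i, r)\<in>set c. ball (d i) (real_of_rat r))"

lemma diameter_ball_le:
  fixes x :: "'a::metric_space"
  shows "diameter (ball x r) \<le> 2 * \<bar>r\<bar>"
proof (cases "ball x r = {}")
  case False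
  have "dist y z \<le> 2 * \<bar>r\<bar>" if "y \<in> ball x r" "z \<in> ball x r" for y z
    using that dist_triangle3[of y z x] by simp
  with False show ?thesis
    unfolding diameter_def by (auto intro!: cSUP_least)
next
  case True
  then have "diameter (ball x r) = 0" by (simp only: diameter_empty)
  then show ?thesis by simp
qed

text \<open>
  A cover of total diameter less than \<open>\<delta>\<close> consists of sets of diameter less than \<open>\<delta>\<close>, so a
  smallness condition on the sum alone already controls every content in the supremum.
\<close>

lemma hausdorff_measure1_eq_0I:
  assumes "\<And>e. 0 < e \<Longrightarrow> \<exists>c. total_radius c < e \<and> A \<subseteq> ball_union d c"
  shows "hausdorff_measure1 A = 0"
proof -
  have content: "hausdorff_content1 \<delta> A \<le> ennreal e" if "0 < \<delta>" "0 < e" for \<delta> e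
  proof -
    have "0 < min \<delta> e / 2" using that by simp
    then obtain c where c: "total_radius c < min \<delta> e / 2" "A \<subseteq> ball_union d c"
      using assms by blast
    define E where "E k = (if k < length c then (case c ! k of (i, r) \<Rightarrow> ball (d i) (real_of_rat r)) else {})" for k
    define \<rho> where "\<rho> k = (if k < length c then 2 * \<bar>real_of_rat (snd (c ! k))\<bar> else 0)" for k
    have diam: "diameter (E k) \<le> \<rho> k" for k
      using diameter_ball_le[of "d (fst (c ! k))" "real_of_rat (snd (c ! k))"]
      by (simp add: E_def \<rho>_def case_prod_beta)
    have bdd: "bounded (E k)" for k
      by (auto simp: E_def split: prod.split)
    have "(\<Sum>k<length c. \<rho> k) = 2 * total_radius c"
      by (auto simp: total_radius_def \<rho>_def sum_list_sum_nth sum_distrib_left atLeast0LessThan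
          case_prod_beta intro!: sum.cong)
    then have total: "(\<Sum>k<length c. \<rho> k) < min \<delta> e" using c(1) by simp
    have "\<rho> k \<le> \<delta>" for k
    proof (cases "k < length c")
      case True
      then have "\<rho> k \<le> (\<Sum>k<length c. \<rho> k)"
        by (intro member_le_sum) (auto simp: \<rho>_def)
      with total show ?thesis by simp
    next
      case False
      then show ?thesis using that by (simp add: \<rho>_def)
    qed
    then have small: "diameter (E k) \<le> \<delta>" for k
      using diam order_trans by blast
    have cov: "A \<subseteq> (\<Union>k. E k)"
    proof
      fix x assume "x \<in> A"
      then obtain i r where "(i, r) \<in> set c" "x \<in> ball (d i) (real_of_rat r)"
        using c(2) by (auto simp: ball_union_def)
      then obtain k where "k < length c" "c ! k = (i, r)" by (meson in_set_conv_nth)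
      with \<open>x \<in> ball (d i) (real_of_rat r)\<close> have "x \<in> E k" by (simp add: E_def)
      then show "x \<in> (\<Union>k. E k)" by blast
    qed
    have "hausdorff_content1 \<delta> A \<le> (\<Sum>k. ennreal (diameter (E k)))"
      unfolding hausdorff_content1_def by (rule INF_lower) (use bdd small cov in auto)
    also have "\<dots> \<le> (\<Sum>k. ennreal (\<rho> k))"
      by (intro suminf_le ennreal_leI diam) auto
    also have "\<dots> = (\<Sum>k<length c. ennreal (\<rho> k))"
      by (rule suminf_finite) (auto simp: \<rho>_def)
    also have "\<dots> = ennreal (\<Sum>k<length c. \<rho> k)"
      by (rule sum_ennreal) (auto simp: \<rho>_def)
    also have "\<dots> \<le> ennreal e"
      using total by (intro ennreal_leI) simp
    finally show ?thesis .
  qed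
  have "hausdorff_content1 \<delta> A \<le> 0" if "0 < \<delta>" for \<delta>
  proof (rule ennreal_le_epsilon)
    fix e :: real assume "0 < e"
    from content[OF that this] show "hausdorff_content1 \<delta> A \<le> 0 + ennreal e" by simp
  qed
  then have "hausdorff_measure1 A \<le> 0"
    unfolding hausdorff_measure1_def by (intro SUP_least) auto
  then show ?thesis by simp
qed

text \<open>
  Each set of a countable cover that meets \<open>K\<close> lies in a ball around a nearby centre whose radius
  barely exceeds its diameter; compactness extracts a finite family.
\<close>

lemma small_ball_union_of_null_compact:
  fixes d :: "'i \<Rightarrow> 'a::metric_space"
  assumes K: "compact K" and null: "hausdorff_measure1 K = 0"
    and dense: "K \<subseteq> closure (range d)" and "0 < e"
  shows "\<exists>c. total_radius c < e \<and> K \<subseteq> ball_union d c"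
proof -
  have "hausdorff_content1 1 K \<le> hausdorff_measure1 K"
    unfolding hausdorff_measure1_def by (rule SUP_upper) simp
  then have "hausdorff_content1 1 K < ennreal (e/2)"
    using null \<open>0 < e\<close> by simp
  then obtain E :: "nat \<Rightarrow> 'a set" where bdd: "\<And>i. bounded (E i)"
    and cov: "K \<subseteq> (\<Union>i. E i)" and sum: "(\<Sum>i. ennreal (diameter (E i))) < ennreal (e/2)"
    unfolding hausdorff_content1_def INF_less_iff by auto
  \<comment> \<open>The excess of the radii over the diameters sums to at most \<open>e/2\<close>.\<close>
  define \<epsilon> where "\<epsilon> i = e / 2 * (1/2)^Suc i" for i
  have \<epsilon>: "0 < \<epsilon> i" for i using \<open>0 < e\<close> by (simp add: \<epsilon>_def)
  have "\<exists>j r. 0 < r \<and> real_of_rat r < diameter (E i) + \<epsilon> i \<and> K \<inter> E i \<subseteq> ball (d j) (real_of_rat r)" for i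
  proof -
    obtain r where r: "diameter (E i) + \<epsilon> i / 2 < real_of_rat r" "real_of_rat r < diameter (E i) + \<epsilon> i"
      using of_rat_dense[of "diameter (E i) + \<epsilon> i / 2" "diameter (E i) + \<epsilon> i"] \<epsilon>[of i] by auto
    have "0 < real_of_rat r" using r diameter_ge_0[OF bdd, of i] \<epsilon>[of i] by linarith
    then have r0: "0 < r" by simp
    show ?thesis
    proof (cases "K \<inter> E i = {}")
      case True
      with r r0 show ?thesis by blast
    next
      case False
      then obtain x where x: "x \<in> K" "x \<in> E i" by blast
      obtain j where j: "dist (d j) x < \<epsilon> i / 2"
        using dense x \<epsilon>[of i] half_gt_zero closure_approachable[of x "range d"] by blast
      have "y \<in> ball (d j) (real_of_rat r)" if "y \<in> E i" for y
        using dist_triangle[of "d j" y x] diameter_bounded_bound[OF bdd x(2) that] j r by simp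
      with r r0 show ?thesis by blast
    qed
  qed
  then obtain j r where r0: "\<And>i. 0 < r i" and r: "\<And>i. real_of_rat (r i) < diameter (E i) + \<epsilon> i"
    and sub: "\<And>i. K \<inter> E i \<subseteq> ball (d (j i)) (real_of_rat (r i))" by metis
  have "K \<subseteq> (\<Union>i. ball (d (j i)) (real_of_rat (r i)))" using cov sub by blast
  then obtain I where I: "finite I" "K \<subseteq> (\<Union>i\<in>I. ball (d (j i)) (real_of_rat (r i)))"
    using compactE_image[OF K, of UNIV "\<lambda>i. ball (d (j i)) (real_of_rat (r i))"] by auto
  obtain l where l: "set l = I" "distinct l" using finite_distinct_list[OF I(1)] by blast
  define c where "c = map (\<lambda>i. (j i, r i)) l"
  have "K \<subseteq> ball_union d c"
    using I(2) l(1) by (auto simp: ball_union_def c_def)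
  moreover have "total_radius c < e"
  proof -
    have "(\<Sum>i\<in>I. ennreal (diameter (E i))) \<le> (\<Sum>i. ennreal (diameter (E i)))"
      by (rule sum_le_suminf) (use I in auto)
    then have "ennreal (\<Sum>i\<in>I. diameter (E i)) < ennreal (e/2)"
      using sum by (subst sum_ennreal[symmetric]) (auto simp: diameter_ge_0 bdd)
    then have 1: "(\<Sum>i\<in>I. diameter (E i)) < e/2"
      by (subst (asm) ennreal_less_iff) (auto simp: diameter_ge_0 bdd intro!: sum_nonneg)
    have "(\<Sum>i\<in>I. (1/2::real)^Suc i) \<le> (\<Sum>i. (1/2)^Suc i)"
      by (rule sum_le_suminf) (use I power_half_series in \<open>auto simp: sums_iff\<close>)
    also have "\<dots> = 1" using power_half_series by (simp add: sums_iff)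
    finally have "e / 2 * (\<Sum>i\<in>I. (1/2::real)^Suc i) \<le> e / 2 * 1"
      using \<open>0 < e\<close> by (intro mult_left_mono) auto
    then have 2: "(\<Sum>i\<in>I. \<epsilon> i) \<le> e/2"
      unfolding \<epsilon>_def sum_distrib_left by simp
    have "total_radius c = (\<Sum>i\<in>I. real_of_rat (r i))"
      using l r0 by (simp add: total_radius_def c_def comp_def sum_list_distinct_conv_sum_set less_imp_le)
    also have "\<dots> \<le> (\<Sum>i\<in>I. diameter (E i) + \<epsilon> i)"
      by (intro sum_mono less_imp_le r)
    also have "\<dots> < e" using 1 2 by (simp add: sum.distrib)
    finally show ?thesis .
  qed
  ultimately show ?thesis by blast
qed

section \<open>Differentiable curves given by rational data\<close>

text \<open>
  This is differentiability with derivative \<open>g\<close>, uniformly on \<open>S\<close>.  It makes sense on a set such as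
  the rationals of an interval, passes to the closure, and on \<open>[0,1]\<close> it already forces \<open>g\<close> to be
  continuous.
\<close>

definition uniform_deriv_on :: "real set \<Rightarrow> (real \<Rightarrow> 'a::real_normed_vector) \<Rightarrow> (real \<Rightarrow> 'a) \<Rightarrow> bool"
  where "uniform_deriv_on S f g \<longleftrightarrow> (\<forall>e>0. \<exists>d>0. \<forall>s\<in>S. \<forall>t\<in>S. \<bar>s - t\<bar> < d \<longrightarrow>
    norm (f t - f s - (t - s) *\<^sub>R g s) \<le> e * \<bar>s - t\<bar>)"

text \<open>
  Adding the estimates for \<open>(s, t)\<close> and \<open>(t, s)\<close> cancels the values of \<open>f\<close> and leaves
  \<open>(t - s) (g t - g s)\<close>.
\<close>

lemma uniform_deriv_on_uniformly_continuous:
  assumes "uniform_deriv_on S f g"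
  shows "uniformly_continuous_on S g"
  unfolding uniformly_continuous_on_def
proof (intro allI impI)
  fix e :: real assume "0 < e"
  then have "0 < e/3" by simp
  then obtain d where "0 < d" and d: "\<And>s t. s \<in> S \<Longrightarrow> t \<in> S \<Longrightarrow> \<bar>s - t\<bar> < d \<Longrightarrow>
      norm (f t - f s - (t - s) *\<^sub>R g s) \<le> e/3 * \<bar>s - t\<bar>"
    using assms unfolding uniform_deriv_on_def by meson
  have "dist (g t) (g s) < e" if st: "s \<in> S" "t \<in> S" "dist t s < d" for s t
  proof (cases "s = t")
    case False
    have "\<bar>s - t\<bar> * norm (g t - g s) = norm ((f t - f s - (t - s) *\<^sub>R g s) + (f s - f t - (s - t) *\<^sub>R g t))"
      by (simp add: algebra_simps flip: norm_scaleR)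
        (simp add: norm_minus_commute flip: scaleR_diff_right scaleR_diff_left)
    also have "\<dots> \<le> e/3 * \<bar>s - t\<bar> + e/3 * \<bar>s - t\<bar>"
      using d[of s t] d[of t s] st by (intro norm_triangle_mono) (auto simp: dist_real_def abs_minus_commute)
    also have "\<dots> < \<bar>s - t\<bar> * e" using False \<open>0 < e\<close> by (simp add: field_simps)
    finally show ?thesis using False by (simp add: dist_norm)
  qed (use \<open>0 < e\<close> in simp)
  then show "\<exists>d>0. \<forall>x\<in>S. \<forall>x'\<in>S. dist x' x < d \<longrightarrow> dist (g x') (g x) < e"
    using \<open>0 < d\<close> by blast
qed

text \<open>
  From left to right this is the mean value inequality together with the uniform continuity of the
  derivative on the compact interval.
\<close>

lemma C1_curve_iff_uniform_deriv_on: "C1_curve f \<longleftrightarrow> (\<exists>g. uniform_deriv_on {0..1} f g)"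
proof
  assume "C1_curve f"
  then obtain f' where f': "\<And>x. x \<in> {0..1} \<Longrightarrow> (f has_derivative blinfun_apply (f' x)) (at x within {0..1})"
    and cont: "continuous_on {0..1} f'"
    unfolding C1_curve_def by blast
  have "uniformly_continuous_on {0..1} f'"
    using cont by (simp add: compact_uniformly_continuous)
  have "uniform_deriv_on {0..1} f (\<lambda>s. blinfun_apply (f' s) 1)"
    unfolding uniform_deriv_on_def
  proof (intro allI impI)
    fix e :: real assume "0 < e"
    then obtain d where "0 < d" and d: "\<And>s t. s \<in> {0..1} \<Longrightarrow> t \<in> {0..1} \<Longrightarrow> dist t s < d \<Longrightarrow> dist (f' t) (f' s) < e"
      using \<open>uniformly_continuous_on {0..1} f'\<close> unfolding uniformly_continuous_on_def by meson
    have "norm (f t - f s - (t - s) *\<^sub>R blinfun_apply (f' s) 1) \<le> e * \<bar>s - t\<bar>"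
      if st: "s \<in> {0..1}" "t \<in> {0..1}" "\<bar>s - t\<bar> < d" for s t
    proof -
      have seg: "closed_segment s t \<subseteq> {0..1}"
        using st by (simp add: closed_segment_subset)
      have "norm (f t - f s - blinfun_apply (f' s) (t - s)) \<le> norm (t - s) * e"
      proof (rule differentiable_bound_linearization[where S = "closed_segment s t" and f' = "\<lambda>x. blinfun_apply (f' x)"])
        show "s + r *\<^sub>R (t - s) \<in> closed_segment s t" if "r \<in> {0..1}" for r
          using that by (auto simp: closed_segment_def algebra_simps intro!: exI[of _ r])
        show "(f has_derivative blinfun_apply (f' x)) (at x within closed_segment s t)"
          if "x \<in> closed_segment s t" for x
          using f' seg that by (meson has_derivative_subset subsetD)
        show "onorm (blinfun_apply (f' x) - blinfun_apply (f' s)) \<le> e" if "x \<in> closed_segment s t" for x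
        proof -
          have "dist (f' x) (f' s) < e"
            using d[of s x] st seg that by (auto simp: closed_segment_eq_real_ivl dist_real_def split: if_splits)
          then show ?thesis
            by (simp add: dist_norm norm_blinfun.rep_eq minus_blinfun.rep_eq fun_diff_def)
        qed
      qed simp
      moreover have "blinfun_apply (f' s) (t - s) = (t - s) *\<^sub>R blinfun_apply (f' s) 1"
        by (metis blinfun.scaleR_right mult.right_neutral real_scaleR_def)
      ultimately show ?thesis by (simp add: mult.commute abs_minus_commute)
    qed
    with \<open>0 < d\<close> show "\<exists>d>0. \<forall>s\<in>{0..1}. \<forall>t\<in>{0..1}. \<bar>s - t\<bar> < d \<longrightarrow>
        norm (f t - f s - (t - s) *\<^sub>R blinfun_apply (f' s) 1) \<le> e * \<bar>s - t\<bar>" by blast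
  qed
  then show "\<exists>g. uniform_deriv_on {0..1} f g" by blast
next
  assume "\<exists>g. uniform_deriv_on {0..1} f g"
  then obtain g where g: "uniform_deriv_on {0..1} f g" by blast
  have "(f has_derivative blinfun_apply (blinfun_scaleR_left (g x))) (at x within {0..1})" if "x \<in> {0..1}" for x
    unfolding has_derivative_within_alt
  proof (intro conjI allI impI)
    fix e :: real assume "0 < e"
    then obtain d where "d>0" and d: "\<forall>s\<in>{0..1}. \<forall>t\<in>{0..1}. \<bar>s - t\<bar> < d \<longrightarrow>
        norm (f t - f s - (t - s) *\<^sub>R g s) \<le> e * \<bar>s - t\<bar>"
      using g unfolding uniform_deriv_on_def by meson
    from bspec[OF d that] \<open>d > 0\<close> show "\<exists>d>0. \<forall>y\<in>{0..1}. norm (y - x) < d \<longrightarrow>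
        norm (f y - f x - blinfun_apply (blinfun_scaleR_left (g x)) (y - x)) \<le> e * norm (y - x)"
      by (intro exI[of _ d]) (simp add: abs_minus_commute[of x])
  qed (rule blinfun.bounded_linear_right)
  moreover have "continuous_on {0..1} (\<lambda>x. blinfun_scaleR_left (g x))"
    by (intro bounded_linear.continuous_on[OF bounded_linear_blinfun_scaleR_left]
        uniformly_continuous_imp_continuous uniform_deriv_on_uniformly_continuous[OF g])
  ultimately show "C1_curve f"
    unfolding C1_curve_def by (intro exI[of _ "\<lambda>x. blinfun_scaleR_left (g x)"]) blast
qed

lemma uniform_deriv_on_closure:
  assumes "uniform_deriv_on S f g" "continuous_on (closure S) f" "continuous_on (closure S) g"
  shows "uniform_deriv_on (closure S) f g"
  unfolding uniform_deriv_on_def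
proof (intro allI impI)
  fix e :: real assume "0 < e"
  then obtain d where "0 < d" and d: "\<And>s t. s \<in> S \<Longrightarrow> t \<in> S \<Longrightarrow> \<bar>s - t\<bar> < d \<Longrightarrow>
      norm (f t - f s - (t - s) *\<^sub>R g s) \<le> e * \<bar>s - t\<bar>"
    using assms(1) unfolding uniform_deriv_on_def by meson
  have "norm (f t - f s - (t - s) *\<^sub>R g s) \<le> e * \<bar>s - t\<bar>"
    if st: "s \<in> closure S" "t \<in> closure S" "\<bar>s - t\<bar> < d" for s t
  proof -
    obtain x y where x: "\<And>n. x n \<in> S" "x \<longlonglongrightarrow> s" and y: "\<And>n. y n \<in> S" "y \<longlonglongrightarrow> t"
      using st by (meson closure_sequential)
    have lim: "(\<lambda>n. h (z n)) \<longlonglongrightarrow> h r"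
      if "continuous_on (closure S) h" "\<And>n. z n \<in> S" "z \<longlonglongrightarrow> r" "r \<in> closure S"
      for h :: "real \<Rightarrow> 'a" and z r
    proof (rule continuous_on_tendsto_compose[OF that(1,3,4)])
      show "\<forall>\<^sub>F n in sequentially. z n \<in> closure S"
        using that(2) closure_subset by (intro always_eventually) blast
    qed
    show ?thesis
    proof (rule tendsto_le)
      show "(\<lambda>n. norm (f (y n) - f (x n) - (y n - x n) *\<^sub>R g (x n))) \<longlonglongrightarrow> norm (f t - f s - (t - s) *\<^sub>R g s)"
        by (intro tendsto_intros lim assms x y st)
      show "(\<lambda>n. e * \<bar>x n - y n\<bar>) \<longlonglongrightarrow> e * \<bar>s - t\<bar>"
        by (intro tendsto_intros x y)
      have "(\<lambda>n. \<bar>x n - y n\<bar>) \<longlonglongrightarrow> \<bar>s - t\<bar>" by (intro tendsto_intros x y)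
      then have "\<forall>\<^sub>F n in sequentially. \<bar>x n - y n\<bar> < d"
        using st(3) order_tendstoD(2) by blast
      then show "\<forall>\<^sub>F n in sequentially. norm (f (y n) - f (x n) - (y n - x n) *\<^sub>R g (x n)) \<le> e * \<bar>x n - y n\<bar>"
        by eventually_elim (use d x y in blast)
    qed simp
  qed
  with \<open>0 < d\<close> show "\<exists>d>0. \<forall>s\<in>closure S. \<forall>t\<in>closure S. \<bar>s - t\<bar> < d \<longrightarrow>
      norm (f t - f s - (t - s) *\<^sub>R g s) \<le> e * \<bar>s - t\<bar>" by blast
qed

lemma uniform_deriv_on_cong:
  assumes "\<And>x. x \<in> S \<Longrightarrow> f x = f' x" "\<And>x. x \<in> S \<Longrightarrow> g x = g' x"
  shows "uniform_deriv_on S f g \<longleftrightarrow> uniform_deriv_on S f' g'"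
  unfolding uniform_deriv_on_def using assms by (simp cong: ball_cong)

text \<open>
  Uniformly continuous functions into a complete space extend to the closure.  Boundedness of \<open>S\<close>
  makes \<open>g\<close> bounded, and hence \<open>f\<close> Lipschitz at small scales.
\<close>

lemma uniform_deriv_on_extend:
  fixes f g :: "real \<Rightarrow> 'a::banach"
  assumes fg: "uniform_deriv_on S f g" and "bounded S"
  obtains f' g' where "uniform_deriv_on (closure S) f' g'" "\<And>x. x \<in> S \<Longrightarrow> f' x = f x"
proof -
  obtain g' where g': "uniformly_continuous_on (closure S) g'" "\<And>x. x \<in> S \<Longrightarrow> g x = g' x"
    using uniformly_continuous_on_extension_on_closure[OF uniform_deriv_on_uniformly_continuous[OF fg]] by metis
  have "bounded (g' ` closure S)"
    using g'(1) \<open>bounded S\<close>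
    by (intro compact_imp_bounded compact_continuous_image uniformly_continuous_imp_continuous) auto
  then obtain M where "0 < M" and M: "\<And>x. x \<in> S \<Longrightarrow> norm (g x) \<le> M"
    using g'(2) closure_subset unfolding bounded_pos by (metis imageI subsetD)
  have "uniformly_continuous_on S f"
    unfolding uniformly_continuous_on_def
  proof (intro allI impI)
    fix e :: real assume "0 < e"
    obtain d where "0 < d" and d: "\<And>s t. s \<in> S \<Longrightarrow> t \<in> S \<Longrightarrow> \<bar>s - t\<bar> < d \<Longrightarrow>
        norm (f t - f s - (t - s) *\<^sub>R g s) \<le> 1 * \<bar>s - t\<bar>"
      using fg zero_less_one unfolding uniform_deriv_on_def by meson
    have "dist (f t) (f s) < e" if st: "s \<in> S" "t \<in> S" "dist t s < min d (e / (M + 1))" for s t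
    proof -
      have "norm (f t - f s) \<le> norm (f t - f s - (t - s) *\<^sub>R g s) + norm ((t - s) *\<^sub>R g s)"
        using norm_triangle_ineq[of "f t - f s - (t - s) *\<^sub>R g s" "(t - s) *\<^sub>R g s"] by simp
      also have "\<dots> \<le> 1 * \<bar>t - s\<bar> + \<bar>t - s\<bar> * M"
        using d[of s t] M[of s] st
        by (intro add_mono) (auto simp: dist_real_def abs_minus_commute mult_left_mono)
      also have "\<dots> < e"
        using st(3) \<open>0 < M\<close> by (simp add: dist_real_def field_simps)
      finally show ?thesis by (simp add: dist_norm)
    qed
    moreover have "0 < min d (e / (M + 1))" using \<open>0 < d\<close> \<open>0 < e\<close> \<open>0 < M\<close> by simp
    ultimately show "\<exists>d>0. \<forall>x\<in>S. \<forall>x'\<in>S. dist x' x < d \<longrightarrow> dist (f x') (f x) < e" by blast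
  qed
  then obtain f' where f': "uniformly_continuous_on (closure S) f'" "\<And>x. x \<in> S \<Longrightarrow> f x = f' x"
    using uniformly_continuous_on_extension_on_closure by metis
  have "uniform_deriv_on S f' g'"
    using fg uniform_deriv_on_cong[of S f f' g g'] f'(2) g'(2) by blast
  then have "uniform_deriv_on (closure S) f' g'"
    using f'(1) g'(1) by (intro uniform_deriv_on_closure uniformly_continuous_imp_continuous)
  with f'(2) that show ?thesis by metis
qed

text \<open>
  For functions given on the rationals, uniform differentiability is a countable combination of
  closed conditions.  Composing with \<open>inv real_of_rat\<close> turns them into functions on the reals;
  off the rationals these take arbitrary values, but the estimate is only
  required on \<open>real_of_rat ` Q\<close>.
\<close>

lemma uniform_deriv_on_rats_iff:
  fixes Q :: "rat set"
  shows "uniform_deriv_on (real_of_rat ` Q) (p \<circ> inv real_of_rat) (g \<circ> inv real_of_rat) \<longleftrightarrow>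
    (\<forall>n::nat. \<exists>m::nat. \<forall>s\<in>Q. \<forall>t\<in>Q. \<bar>real_of_rat s - real_of_rat t\<bar> < 1 / Suc m \<longrightarrow>
      norm (p t - p s - (real_of_rat t - real_of_rat s) *\<^sub>R g s) \<le> 1 / Suc n * \<bar>real_of_rat s - real_of_rat t\<bar>)"
    (is "?L \<longleftrightarrow> (\<forall>n. \<exists>m. ?R n m)")
proof -
  have inv: "inv real_of_rat (real_of_rat q) = q" for q
    by (simp add: inv_f_f inj_def)
  define P where "P e d \<longleftrightarrow> (\<forall>s\<in>Q. \<forall>t\<in>Q. \<bar>real_of_rat s - real_of_rat t\<bar> < d \<longrightarrow>
      norm (p t - p s - (real_of_rat t - real_of_rat s) *\<^sub>R g s) \<le> e * \<bar>real_of_rat s - real_of_rat t\<bar>)" for e d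
  have mono: "P e' d'" if "P e d" "e \<le> e'" "d' \<le> d" for e e' d d'
    unfolding P_def
  proof (intro ballI impI)
    fix s t assume st: "s \<in> Q" "t \<in> Q" "\<bar>real_of_rat s - real_of_rat t\<bar> < d'"
    then have "norm (p t - p s - (real_of_rat t - real_of_rat s) *\<^sub>R g s) \<le> e * \<bar>real_of_rat s - real_of_rat t\<bar>"
      using that unfolding P_def by auto
    also have "\<dots> \<le> e' * \<bar>real_of_rat s - real_of_rat t\<bar>"
      using that by (intro mult_right_mono) auto
    finally show "norm (p t - p s - (real_of_rat t - real_of_rat s) *\<^sub>R g s) \<le> e' * \<bar>real_of_rat s - real_of_rat t\<bar>" .
  qed
  have "?L \<longleftrightarrow> (\<forall>e>0. \<exists>d>0. P e d)"
    unfolding uniform_deriv_on_def P_def by (simp add: inv)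
  also have "\<dots> \<longleftrightarrow> (\<forall>n::nat. \<exists>m::nat. P (1 / Suc n) (1 / Suc m))"
  proof (intro iffI allI impI)
    fix n :: nat assume "\<forall>e>0. \<exists>d>0. P e d"
    then obtain d where "0 < d" "P (1 / Suc n) d" by (meson of_nat_0_less_iff zero_less_Suc zero_less_divide_1_iff)
    moreover obtain m where "1 / Suc m < d" using nat_approx_posE[OF \<open>0 < d\<close>] .
    ultimately show "\<exists>m. P (1 / Suc n) (1 / Suc m)"
      by (metis mono order_refl less_imp_le)
  next
    fix e :: real assume P: "\<forall>n::nat. \<exists>m::nat. P (1 / Suc n) (1 / Suc m)" and "0 < e"
    obtain n where "1 / Suc n < e" using nat_approx_posE[OF \<open>0 < e\<close>] .
    with P show "\<exists>d>0. P e d"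
      by (metis mono order_refl less_imp_le of_nat_0_less_iff zero_less_Suc zero_less_divide_1_iff)
  qed
  finally show ?thesis unfolding P_def .
qed

lemma closure_of_rat_unit_interval: "closure (real_of_rat ` {0..1}) = {0..1}"
proof
  show "closure (real_of_rat ` {0..1}) \<subseteq> {0..1}"
    by (rule closure_minimal) auto
  show "{0..1} \<subseteq> closure (real_of_rat ` {0..1})"
  proof
    fix x :: real assume x: "x \<in> {0..1}"
    have "\<exists>y\<in>real_of_rat ` {0..1}. dist y x < e" if "0 < e" for e
    proof -
      have "max 0 (x - e) < min 1 (x + e)" using x that by auto
      then obtain q where q: "max 0 (x - e) < real_of_rat q" "real_of_rat q < min 1 (x + e)"
        using of_rat_dense by blast
      then have "real_of_rat 0 < real_of_rat q" "real_of_rat q < real_of_rat 1" by simp_all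
      then have "0 < q" "q < 1" by (simp_all only: of_rat_less)
      moreover have "dist (real_of_rat q) x < e" using q by (simp add: dist_real_def abs_less_iff)
      ultimately show ?thesis by (auto intro!: bexI[of _ "real_of_rat q"])
    qed
    then show "x \<in> closure (real_of_rat ` {0..1})" by (simp add: closure_approachable)
  qed
qed

lemma curve_eq_closure_rational_points:
  fixes f :: "real \<Rightarrow> 'a::metric_space"
  assumes "continuous_on {0..1} f"
  shows "f ` {0..1} = closure ((\<lambda>q. f (real_of_rat q)) ` {0..1})"
proof
  have "f ` closure (real_of_rat ` {0..1}) \<subseteq> closure (f ` real_of_rat ` {0..1})"
    by (rule continuous_image_closure_subset[of "{0..1}"]) (use assms closure_of_rat_unit_interval in auto)
  then show "f ` {0..1} \<subseteq> closure ((\<lambda>q. f (real_of_rat q)) ` {0..1})"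
    by (simp add: closure_of_rat_unit_interval image_image)
  show "closure ((\<lambda>q. f (real_of_rat q)) ` {0..1}) \<subseteq> f ` {0..1}"
    by (intro closure_minimal compact_imp_closed compact_continuous_image assms) auto
qed

lemma C1_curve_continuous_on: "C1_curve f \<Longrightarrow> continuous_on {0..1} f"
  unfolding C1_curve_def continuous_on_eq_continuous_within
  using has_derivative_continuous by fast

section \<open>Countable codes for curves with non-null intersection\<close>

text \<open>
  Here \<open>p\<close> and \<open>g\<close> are the values and derivatives of a \<open>C\<^sup>1\<close>-curve at the rationals of \<open>[0,1]\<close>, and
  \<open>w c\<close> is a point of \<open>A\<close> on the curve which the ball family \<open>c\<close> fails to cover, whenever the radii
  of \<open>c\<close> have a sum below a fixed positive bound.
\<close>

definition nonnull_curve_code ::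
    "'a::real_normed_vector set \<Rightarrow> (rat \<Rightarrow> 'a) \<Rightarrow> (rat \<Rightarrow> 'a) \<Rightarrow> ((rat \<times> rat) list \<Rightarrow> 'a) \<Rightarrow> bool"
  where "nonnull_curve_code A p g w \<longleftrightarrow>
    uniform_deriv_on (real_of_rat ` {0..1}) (p \<circ> inv real_of_rat) (g \<circ> inv real_of_rat) \<and>
    (\<exists>n::nat. \<forall>c. total_radius c < 1 / Suc n \<longrightarrow>
       w c \<in> A \<and> w c \<in> closure (p ` {0..1}) \<and> w c \<notin> ball_union p c)"

lemma not_purely_unrectifiable_iff:
  fixes A :: "'a::banach set"
  assumes "closed A"
  shows "\<not> purely_unrectifiable A \<longleftrightarrow> (\<exists>p g w. nonnull_curve_code A p g w)"
proof
  assume "\<not> purely_unrectifiable A"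
  then obtain f where f: "C1_curve f" and pos: "hausdorff_measure1 (A \<inter> f ` {0..1}) \<noteq> 0"
    unfolding purely_unrectifiable_def by blast
  define p where "p q = f (real_of_rat q)" for q
  obtain g where g: "uniform_deriv_on {0..1} f g" using f by (auto simp: C1_curve_iff_uniform_deriv_on)
  have "uniform_deriv_on (real_of_rat ` {0..1}) f g"
    using g closure_subset[of "real_of_rat ` {0..1}"]
    unfolding uniform_deriv_on_def closure_of_rat_unit_interval by (meson subsetD)
  then have "uniform_deriv_on (real_of_rat ` {0..1}) (p \<circ> inv real_of_rat) ((g \<circ> real_of_rat) \<circ> inv real_of_rat)"
    by (subst uniform_deriv_on_cong[of _ _ f _ g]) (auto simp: p_def inv_f_f inj_def)
  moreover obtain e where "0 < e"
    and e: "\<And>c. total_radius c < e \<Longrightarrow> \<not> A \<inter> f ` {0..1} \<subseteq> ball_union p c"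
    using hausdorff_measure1_eq_0I[of "A \<inter> f ` {0..1}" p] pos by blast
  moreover obtain n where n: "1 / Suc n < e" using nat_approx_posE[OF \<open>0 < e\<close>] .
  moreover have "f ` {0..1} = closure (p ` {0..1})"
    unfolding p_def by (intro curve_eq_closure_rational_points C1_curve_continuous_on f)
  then have "\<exists>x. total_radius c < 1 / Suc n \<longrightarrow> x \<in> A \<and> x \<in> closure (p ` {0..1}) \<and> x \<notin> ball_union p c" for c
    using e[of c] n by force
  then obtain w where "\<And>c. total_radius c < 1 / Suc n \<Longrightarrow>
      w c \<in> A \<and> w c \<in> closure (p ` {0..1}) \<and> w c \<notin> ball_union p c" by metis
  ultimately show "\<exists>p g w. nonnull_curve_code A p g w"
    unfolding nonnull_curve_code_def by blast
next
  assume "\<exists>p g w. nonnull_curve_code A p g w"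
  then obtain p g w n where
    deriv: "uniform_deriv_on (real_of_rat ` {0..1}) (p \<circ> inv real_of_rat) (g \<circ> inv real_of_rat)"
    and w: "\<And>c. total_radius c < 1 / Suc n \<Longrightarrow> w c \<in> A \<and> w c \<in> closure (p ` {0..1}) \<and> w c \<notin> ball_union p c"
    unfolding nonnull_curve_code_def by blast
  obtain f g' where f: "uniform_deriv_on {0..1} f g'"
    and fp: "\<And>x. x \<in> real_of_rat ` {0..1} \<Longrightarrow> f x = (p \<circ> inv real_of_rat) x"
    using uniform_deriv_on_extend[OF deriv] unfolding closure_of_rat_unit_interval
    by (metis bounded_closed_interval bounded_subset closure_of_rat_unit_interval closure_subset)
  have C1: "C1_curve f" using f by (auto simp: C1_curve_iff_uniform_deriv_on)
  have "f (real_of_rat q) = p q" if "q \<in> {0..1}" for q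
    using fp[of "real_of_rat q"] that by (simp add: inv_f_f inj_def)
  then have "(\<lambda>q. f (real_of_rat q)) ` {0..1} = p ` {0..1}" by (rule image_cong[OF refl])
  then have ran: "f ` {0..1} = closure (p ` {0..1})"
    using curve_eq_closure_rational_points[OF C1_curve_continuous_on[OF C1]] by simp
  have "compact (A \<inter> f ` {0..1})"
    using assms by (intro closed_Int_compact compact_continuous_image C1_curve_continuous_on C1) auto
  moreover have "A \<inter> f ` {0..1} \<subseteq> closure (range p)"
    unfolding ran using closure_mono[of "p ` {0..1}" "range p"] by blast
  moreover have "\<not> (\<exists>c. total_radius c < 1 / Suc n \<and> A \<inter> f ` {0..1} \<subseteq> ball_union p c)"
    using w unfolding ran by blast
  ultimately have "hausdorff_measure1 (A \<inter> f ` {0..1}) \<noteq> 0"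
    using small_ball_union_of_null_compact[of "A \<inter> f ` {0..1}" p "1 / Suc n"] by auto
  with C1 show "\<not> purely_unrectifiable A"
    unfolding purely_unrectifiable_def by blast
qed

section \<open>Borel sets and projections\<close>

lemma space_borel_of [simp]: "space (borel_of X) = topspace X"
  by (simp add: borel_of_def space_measure_of_conv)

lemma sets_borel_of: "sets (borel_of X) = sigma_sets (topspace X) {U. openin X U}"
  unfolding borel_of_def by (rule sets_measure_of) (auto dest: openin_subset)

lemma borel_of_euclidean: "sets (borel_of (euclidean :: 'a::topological_space topology)) = sets borel"
  by (simp add: borel_of_def borel_def)

lemma measurable_borel_of_continuous_map:
  assumes "continuous_map X Y f"
  shows "f \<in> measurable (borel_of X) (borel_of Y)"
  unfolding borel_of_def[of Y]
proof (rule measurable_measure_of)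
  show "f \<in> space (borel_of X) \<rightarrow> topspace Y"
    using assms continuous_map_funspace by fastforce
  fix U assume "U \<in> {U. openin Y U}"
  then have "openin X {x \<in> topspace X. f x \<in> U}"
    using assms openin_continuous_map_preimage by blast
  moreover have "f -` U \<inter> space (borel_of X) = {x \<in> topspace X. f x \<in> U}" by auto
  ultimately show "f -` U \<inter> space (borel_of X) \<in> sets (borel_of X)"
    by (simp add: sets_borel_of)
qed (auto dest: openin_subset)

text \<open>
  An injection of a Polish space into \<open>nat \<Rightarrow> real\<close> makes its range, with the transported
  topology, an admissible auxiliary space; every Polish space admits such an injection.
\<close>

lemma analytic_in_projection:
  fixes B :: "('a \<times> 'b::polish_space) set" and j :: "'b \<Rightarrow> nat \<Rightarrow> real"
  assumes "inj j" and B: "B \<in> sets (borel_of (prod_topology X euclidean))"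
  shows "analytic_in X (fst ` B)"
proof -
  define Y where "Y = pullback_topology (range j) (inv j) euclidean"
  have top: "topspace Y = range j"
    by (simp add: Y_def topspace_pullback_topology)
  have inv: "continuous_map Y euclidean (inv j)"
    using continuous_map_pullback[of euclidean euclidean id "range j" "inv j"] by (simp add: Y_def)
  have j: "continuous_map euclidean Y j"
    unfolding Y_def by (rule continuous_map_pullback')
      (use \<open>inj j\<close> in \<open>auto simp: comp_def\<close>)
  have hom: "Y homeomorphic_space (euclidean :: 'b topology)"
    unfolding homeomorphic_space_def homeomorphic_maps_def
    using inv j \<open>inj j\<close> by (intro exI[of _ "inv j"] exI[of _ j]) (auto simp: top)
  have "second_countable (euclidean :: 'b topology)"
  proof -
    obtain \<B> :: "'b set set" where \<B>: "countable \<B>" "topological_basis \<B>"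
      using ex_countable_basis by blast
    then show ?thesis
      unfolding second_countable_def
      by (intro exI[of _ \<B>]) (auto simp: topological_basis_open elim!: topological_basisE)
  qed
  then have "polish_topology Y"
    using homeomorphic_completely_metrizable_space[OF hom] homeomorphic_separable_space[OF hom]
    by (simp add: polish_topology_def completely_metrizable_space_euclidean
        second_countable_imp_separable_space)
  \<comment> \<open>Pulling back along the homeomorphism does not change the first projection.\<close>
  moreover define \<phi> where "\<phi> = (\<lambda>(x :: 'a, y). (x, inv j y))"
  have "continuous_map (prod_topology X Y) (prod_topology X euclidean) \<phi>"
    unfolding \<phi>_def case_prod_beta
    by (intro continuous_map_paired[THEN iffD2] conjI continuous_map_fst
        continuous_map_compose[OF continuous_map_snd inv, unfolded comp_def])
  from measurable_sets[OF measurable_borel_of_continuous_map[OF this] B]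
  have "\<phi> -` B \<inter> (topspace X \<times> range j) \<in> sets (borel_of (prod_topology X Y))"
    by (simp add: top)
  moreover have "fst ` B = fst ` (\<phi> -` B \<inter> (topspace X \<times> range j))"
  proof (intro subset_antisym subsetI)
    fix x assume "x \<in> fst ` B"
    then obtain y where xy: "(x, y) \<in> B" by auto
    then have "x \<in> topspace X" using sets.sets_into_space[OF B] by auto
    with xy \<open>inj j\<close> have "(x, j y) \<in> \<phi> -` B \<inter> (topspace X \<times> range j)" by (simp add: \<phi>_def)
    then show "x \<in> fst ` (\<phi> -` B \<inter> (topspace X \<times> range j))" by force
  qed (force simp: \<phi>_def)
  ultimately show ?thesis unfolding analytic_in_def by blast
qed

text \<open>
  A point lies in a closed set iff the set meets every basic open neighbourhood of the point; for
  each basic open set, both halves of this condition are measurable.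
\<close>

lemma pred_mem_closed_set:
  fixes y :: "'b \<Rightarrow> 'a::second_countable_topology"
  assumes S: "S \<in> measurable M effros" and y: "y \<in> borel_measurable M"
  shows "Measurable.pred M (\<lambda>x. y x \<in> S x)"
proof -
  obtain \<B> :: "'a set set" where \<B>: "countable \<B>" "topological_basis \<B>"
    using ex_countable_basis by blast
  have closed: "closed (S x)" if "x \<in> space M" for x
    using measurable_space[OF S that] by (simp add: effros_def space_measure_of_conv)
  have "y x \<in> S x \<longleftrightarrow> (\<forall>V\<in>\<B>. y x \<in> V \<longrightarrow> S x \<inter> V \<noteq> {})" if x: "x \<in> space M" for x
  proof (intro iffI ballI impI)
    assume *: "\<forall>V\<in>\<B>. y x \<in> V \<longrightarrow> S x \<inter> V \<noteq> {}"
    show "y x \<in> S x"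
    proof (rule ccontr)
      assume "y x \<notin> S x"
      then obtain V where "V \<in> \<B>" "y x \<in> V" "V \<subseteq> - S x"
        using topological_basisE[OF \<B>(2), of "- S x" "y x"] closed[OF x] by (auto simp: open_Compl)
      with * show False by blast
    qed
  qed blast
  moreover have "Measurable.pred M (\<lambda>x. \<forall>V\<in>\<B>. y x \<in> V \<longrightarrow> S x \<inter> V \<noteq> {})"
    unfolding pred_def
  proof (intro sets.sets_Collect_countable_All' sets.sets_Collect_imp \<B>(1))
    fix V assume "V \<in> \<B>"
    then have V: "open V" using \<B>(2) topological_basis_open by blast
    from measurable_sets[OF y borel_open[OF V]] show "{x \<in> space M. y x \<in> V} \<in> sets M"
      by (simp add: vimage_def Int_def conj_commute)
    have "{A. closed A \<and> A \<inter> V \<noteq> {}} \<in> sets effros"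
      using V by (auto simp: effros_def)
    from measurable_sets[OF S this] closed show "{x \<in> space M. S x \<inter> V \<noteq> {}} \<in> sets M"
      by (simp add: vimage_def Int_def conj_commute cong: conj_cong)
  qed
  ultimately show ?thesis by (simp cong: measurable_cong)
qed

lemma pred_nonnull_curve_code:
  fixes p g :: "rat \<Rightarrow> 'b \<Rightarrow> 'a::{real_normed_vector, second_countable_topology}"
  assumes S: "S \<in> measurable M effros"
    and [measurable]: "\<And>q. p q \<in> borel_measurable M" "\<And>q. g q \<in> borel_measurable M"
      "\<And>c. w c \<in> borel_measurable M"
  shows "Measurable.pred M (\<lambda>x. nonnull_curve_code (S x) (\<lambda>q. p q x) (\<lambda>q. g q x) (\<lambda>c. w c x))"
proof -
  note [measurable] = pred_mem_closed_set[OF S]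
  have closure: "y \<in> closure (d ` Q) \<longleftrightarrow> (\<forall>n::nat. \<exists>q\<in>Q. dist (d q) y < 1 / Suc n)"
    for y :: 'a and d :: "rat \<Rightarrow> 'a" and Q
  proof -
    have "(\<forall>e>0. \<exists>q\<in>Q. dist (d q) y < e) \<longleftrightarrow> (\<forall>n::nat. \<exists>q\<in>Q. dist (d q) y < 1 / Suc n)"
    proof (intro iffI allI impI)
      fix e :: real assume *: "\<forall>n::nat. \<exists>q\<in>Q. dist (d q) y < 1 / Suc n" and "0 < e"
      obtain n where "1 / Suc n < e" using nat_approx_posE[OF \<open>0 < e\<close>] .
      with * show "\<exists>q\<in>Q. dist (d q) y < e" by (meson less_trans)
    qed auto
    then show ?thesis by (simp add: closure_approachable)
  qed
  have union: "y \<notin> ball_union d c \<longleftrightarrow> (\<forall>x\<in>set c. \<not> dist (d (fst x)) y < real_of_rat (snd x))"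
    for y :: 'a and d :: "rat \<Rightarrow> 'a" and c
    by (auto simp: ball_union_def)
  show ?thesis
    unfolding nonnull_curve_code_def uniform_deriv_on_rats_iff closure union by measurable
qed

theorem proposition6:
  fixes T :: "ell2 set topology"
  assumes "polish_topology T"
    and "topspace T = {A. closed A}"
    and "sets (borel_of T) = sets (effros :: ell2 set measure)"
  shows "coanalytic_in T {A. closed A \<and> purely_unrectifiable A}"
proof -
  define M where "M = borel_of (prod_topology T
    (euclidean :: (rat + rat + (rat \<times> rat) list \<Rightarrow> ell2) topology))"
  define B where "B = {x \<in> space M. nonnull_curve_code (fst x)
    (\<lambda>q. snd x (Inl q)) (\<lambda>q. snd x (Inr (Inl q))) (\<lambda>c. snd x (Inr (Inr c)))}"
  have space: "space M = {A. closed A} \<times> UNIV"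
    by (simp add: M_def assms(2))
  have "fst \<in> measurable M (borel_of T)"
    unfolding M_def by (intro measurable_borel_of_continuous_map continuous_map_fst)
  then have fst: "fst \<in> measurable M effros"
    using measurable_cong_sets[OF refl assms(3)] by blast
  have snd: "(\<lambda>x. snd x i) \<in> borel_measurable M" for i
  proof -
    have "continuous_map euclidean euclidean (\<lambda>z :: rat + rat + (rat \<times> rat) list \<Rightarrow> ell2. z i)"
      by simp
    from continuous_map_compose[OF continuous_map_snd this]
    have "(\<lambda>x. snd x i) \<in> measurable M (borel_of euclidean)"
      unfolding M_def comp_def by (rule measurable_borel_of_continuous_map)
    then show ?thesis
      using measurable_cong_sets[OF refl borel_of_euclidean] by blast
  qed
  have "B \<in> sets M"
    unfolding B_def by (intro predE pred_nonnull_curve_code fst snd)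
  \<comment> \<open>The coordinates of countably many points of \<open>\<ell>\<^sub>2\<close> are arranged in one real sequence.\<close>
  moreover have "inj (\<lambda>z n. case from_nat n of (i, k) \<Rightarrow>
      seq_of (z (i :: rat + rat + (rat \<times> rat) list)) k)" (is "inj ?j")
  proof (rule injI)
    fix z z' assume eq: "?j z = ?j z'"
    have "seq_of (z i) k = seq_of (z' i) k" for i k
      using fun_cong[OF eq, of "to_nat (i, k)"] by simp
    then show "z = z'" by (simp add: seq_of_inject[symmetric] fun_eq_iff)
  qed
  ultimately have "analytic_in T (fst ` B)"
    unfolding M_def by (intro analytic_in_projection)
  moreover have "fst ` B = topspace T - {A. closed A \<and> purely_unrectifiable A}"
  proof -
    have "A \<in> fst ` B \<longleftrightarrow> closed A \<and> \<not> purely_unrectifiable A" for A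
    proof -
      have "A \<in> fst ` B \<longleftrightarrow> closed A \<and> (\<exists>z. nonnull_curve_code A
          (\<lambda>q. z (Inl q)) (\<lambda>q. z (Inr (Inl q))) (\<lambda>c. z (Inr (Inr c))))"
        by (force simp: B_def space)
      also have "(\<exists>z. nonnull_curve_code A (\<lambda>q. z (Inl q)) (\<lambda>q. z (Inr (Inl q))) (\<lambda>c. z (Inr (Inr c))))
          \<longleftrightarrow> (\<exists>p g w. nonnull_curve_code A p g w)"
      proof
        assume "\<exists>p g w. nonnull_curve_code A p g w"
        then obtain p g w where "nonnull_curve_code A p g w" by blast
        then show "\<exists>z. nonnull_curve_code A (\<lambda>q. z (Inl q)) (\<lambda>q. z (Inr (Inl q))) (\<lambda>c. z (Inr (Inr c)))"
          by (intro exI[of _ "case_sum p (case_sum g w)"]) simp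
      qed blast
      finally show ?thesis using not_purely_unrectifiable_iff by blast
    qed
    then show ?thesis using assms(2) by auto
  qed
  ultimately show ?thesis
    unfolding coanalytic_in_def using assms(2) by auto
qed

end
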